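(* Let $y_1,\dots,y_M\in\mathbb{R}^3$ be pairwise distinct, let $\alpha=(\alpha_1,\dots,\alpha_M)\in\mathbb{C}^M$ with $\operatorname{Im}\alpha_j\ge 0$ for all $j$, and let $k>0$ be such that the matrix $P(k,\alpha)$ is invertible. Let $\{\theta_n:n\in\mathbb{N}\}\subset\mathbb{S}^2$ be a countable set of directions with the following property: if an analytic function on $\mathbb{S}^2$ vanishes at $\theta_n$ for all $n\in\mathbb{N}$, then it vanishes identically on $\mathbb{S}^2$. Let $K\subset\mathbb{R}^3$ be a compact set containing $y_1,\dots,y_M$. For $N\in\mathbb{N}$ with $N\ge M$ and $z\in\mathbb{R}^3$ set $$\phi_z=\big(e^{-ik\theta_1\cdot z},e^{-ik\theta_2\cdot z},\dots,e^{-ik\theta_N\cdot z}\big)^T\in\mathbb{C}^N,$$ let $H\in\mathbb{C}^{M\times N}$ and $F\in\mathbb{C}^{N\times N}$ be the matrices $H_{m,l}=e^{iky_m\cdot\theta_l}$ and $F_{jl}=u^\infty(\theta_j,\theta_l)$ built from the first $N$ directions, and let $\mathcal{P}$ be the orthogonal projection of $\mathbb{C}^N$ onto $\operatorname{Range}(F)^\perp$. Then there exists $N_0\in\mathbb{N}$ such that for all $N\ge N_0$ (with $N\ge M$) and for all $z\in K$, $$z\in\{y_1,\dots,y_M\}\iff \phi_z\in\operatorname{Range}(H^* )\iff\phi_z\in\operatorname{Range}(F)\iff \mathcal{P}\phi_z=0,$$ and $\operatorname{rank}(H)=M$.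
   Context: $\mathbb{S}^2=\{x\in\mathbb{R}^3:|x|=1\}$ is the unit sphere; "analytic function on $\mathbb{S}^2$" means complex-valued real-analytic function. $H^*$ is the conjugate transpose of $H$. $\Phi_k(x,y)=\dfrac{e^{ik|x-y|}}{4\pi|x-y|}$ for $x\ne y$ in $\mathbb{R}^3$ is the outgoing fundamental solution of the Helmholtz equation. The points $y_1,\dots,y_M$ are the positions of point scatterers with scattering coefficients $\alpha_1,\dots,\alpha_M\in\mathbb{C}$, and $k>0$ is the wave number. The matrix $P(k,\alpha)\in\mathbb{C}^{M\times M}$ is defined by $$[P(k,\alpha)]_{m,j}=\begin{cases}\Phi_k(y_m,y_j), & m\ne j,\\ \dfrac{ik}{4\pi}-\alpha_j, & m=j.\end{cases}$$ For an incident plane wave $e^{ikx\cdot d}$ with direction $d\in\mathbb{S}^2$, the scattered field is $u^s(x,d)=-\sum_{m,j=1}^M [P(k,\alpha)^{-1}]_{m,j}e^{ik y_j\cdot d}\Phi_k(x,y_m)$, and its far-field pattern is $$u^\infty(\hat x,d)=-\sum_{m,j=1}^M [P(k,\alpha)^{-1}]_{m,j}\,e^{ik(y_j\cdot d-\hat x\cdot y_m)},\qquad \hat x,d\in\mathbb{S}^2.$$ *)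

theory Defs
  imports
    "HOL-Analysis.Analysis"
    "Jordan_Normal_Form.Gauss_Jordan_Elimination"
    "Jordan_Normal_Form.Schur_Decomposition"
    "Jordan_Normal_Form.DL_Rank"
begin

text \<open>
  Conventions. Points of three-dimensional space have type \<open>real^3\<close>. Vectors and matrices whose
  size depends on \<open>M\<close> or \<open>N\<close> are those of Jordan_Normal_Form, indexed from 0; accordingly
  \<open>y\<^sub>1, \<dots>, y\<^sub>M\<close> are \<open>y 0, \<dots>, y (M - 1)\<close>, and likewise for \<open>\<alpha>\<close> and \<open>\<theta>\<close>.
\<close>

definition monomial_at :: "real^'n \<Rightarrow> ('n::finite \<Rightarrow> nat) \<Rightarrow> real^'n \<Rightarrow> real" where
  "monomial_at p \<nu> x = (\<Prod>i\<in>UNIV. (vec_nth x i - vec_nth p i) ^ \<nu> i)"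

text \<open>
  The power series below is summed over all multi-indices \<open>\<nu>\<close>. The relation \<open>has_sum\<close> means
  unconditional, hence absolute, convergence.
\<close>

definition real_analytic_on :: "(real^'n::finite \<Rightarrow> complex) \<Rightarrow> (real^'n) set \<Rightarrow> bool" where
  "real_analytic_on g U \<longleftrightarrow> open U \<and>
     (\<forall>p\<in>U. \<exists>r>0. \<exists>c :: ('n \<Rightarrow> nat) \<Rightarrow> complex.
        \<forall>x\<in>ball p r. ((\<lambda>\<nu>. c \<nu> * complex_of_real (monomial_at p \<nu> x)) has_sum g x) UNIV)"

text \<open>
  The sphere is an analytic submanifold of space, so a function on it is analytic iff near every
  point of the sphere it is the restriction of an analytic function on an open subset of space.
  Values of \<open>f\<close> off the sphere are irrelevant.
\<close>

definition analytic_on_sphere :: "(real^3 \<Rightarrow> complex) \<Rightarrow> bool" where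
  "analytic_on_sphere f \<longleftrightarrow>
     (\<forall>p\<in>sphere 0 1. \<exists>U g. p \<in> U \<and> real_analytic_on g U \<and> (\<forall>x\<in>U \<inter> sphere 0 1. f x = g x))"

definition mat_range :: "complex mat \<Rightarrow> complex vec set" where
  "mat_range A = (\<lambda>v. A *\<^sub>v v) ` carrier_vec (dim_col A)"

text \<open>
  The complement is taken for the Hermitian inner product \<open>v \<bullet>c w\<close> (the constant
  \<open>orthogonal_complement\<close> of Jordan_Normal_Form uses the bilinear form \<open>v \<bullet> w\<close>).
\<close>

definition orth_compl :: "nat \<Rightarrow> complex vec set \<Rightarrow> complex vec set" where
  "orth_compl n W = {v \<in> carrier_vec n. \<forall>w\<in>W. v \<bullet>c w = 0}"

definition orth_proj :: "nat \<Rightarrow> complex vec set \<Rightarrow> complex vec \<Rightarrow> complex vec" where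
  "orth_proj n W v = (THE p. p \<in> W \<and> v - p \<in> orth_compl n W)"

definition Phi :: "real \<Rightarrow> real^3 \<Rightarrow> real^3 \<Rightarrow> complex" where
  "Phi k x y = exp (\<i> * complex_of_real (k * norm (x - y))) / complex_of_real (4 * pi * norm (x - y))"

definition P_mat :: "nat \<Rightarrow> (nat \<Rightarrow> real^3) \<Rightarrow> real \<Rightarrow> (nat \<Rightarrow> complex) \<Rightarrow> complex mat" where
  "P_mat M y k \<alpha> = mat M M (\<lambda>(m, j).
     if m \<noteq> j then Phi k (y m) (y j) else \<i> * complex_of_real k / complex_of_real (4 * pi) - \<alpha> j)"

text \<open>Only meaningful for invertible \<open>P_mat M y k \<alpha>\<close>, for which \<open>mat_inverse\<close> does not return \<open>None\<close>.\<close>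

definition far_field ::
    "nat \<Rightarrow> (nat \<Rightarrow> real^3) \<Rightarrow> real \<Rightarrow> (nat \<Rightarrow> complex) \<Rightarrow> real^3 \<Rightarrow> real^3 \<Rightarrow> complex" where
  "far_field M y k \<alpha> x d =
     - (\<Sum>m<M. \<Sum>j<M. the (mat_inverse (P_mat M y k \<alpha>)) $$ (m, j)
          * exp (\<i> * complex_of_real (k * (inner (y j) d - inner x (y m)))))"

definition phi_vec :: "real \<Rightarrow> (nat \<Rightarrow> real^3) \<Rightarrow> nat \<Rightarrow> real^3 \<Rightarrow> complex vec" where
  "phi_vec k \<theta> N z = vec N (\<lambda>n. exp (- (\<i> * complex_of_real (k * inner (\<theta> n) z))))"

definition H_mat :: "nat \<Rightarrow> (nat \<Rightarrow> real^3) \<Rightarrow> real \<Rightarrow> (nat \<Rightarrow> real^3) \<Rightarrow> nat \<Rightarrow> complex mat" where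
  "H_mat M y k \<theta> N = mat M N (\<lambda>(m, l). exp (\<i> * complex_of_real (k * inner (y m) (\<theta> l))))"

definition F_mat ::
    "nat \<Rightarrow> (nat \<Rightarrow> real^3) \<Rightarrow> real \<Rightarrow> (nat \<Rightarrow> complex) \<Rightarrow> (nat \<Rightarrow> real^3) \<Rightarrow> nat \<Rightarrow> complex mat" where
  "F_mat M y k \<alpha> \<theta> N = mat N N (\<lambda>(j, l). far_field M y k \<alpha> (\<theta> j) (\<theta> l))"

end

theory Submission
  imports
    Defs
    "HOL-Complex_Analysis.Conformal_Mappings"
    "HOL-Real_Asymp.Real_Asymp"
begin

text \<open>
  Write \<open>w\<^sub>z(x) = exp(-\<i>k x\<cdot>z)\<close>. The columns of \<open>H\<^sup>*\<close> are the samples of the waves \<open>w\<^sub>z\<close>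
  for \<open>z = y\<^sub>1, \<dots>, y\<^sub>M\<close> at the first \<open>N\<close> directions, and \<open>\<phi>\<^sub>z\<close> is the sample of \<open>w\<^sub>z\<close>. Hence
  \<open>\<phi>\<^sub>z \<in> Range(H\<^sup>*)\<close> means that \<open>w\<^sub>z\<close> agrees with a combination of the source waves at these
  directions, and the crux is that for large \<open>N\<close> this fails simultaneously for all
  \<open>z \<in> K\<close> that are not sources (\<open>eventually_only_sources_in_span\<close>).

  Compactness reduces that claim to two statements about all directions at once. Suppose that
  non-sources \<open>z\<^sub>j \<in> K\<close> pass the test for the first \<open>j\<close> directions, and let \<open>z\<^sub>j \<rightarrow> x\<close> along a
  subsequence. If a finite combination \<open>G(z) = \<Sum>c\<^sub>n w\<^sub>z(\<theta>\<^sub>n)\<close> vanishes at all sources, it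
  vanishes at \<open>z\<^sub>j\<close> for all large \<open>j\<close>, hence at \<open>x\<close>. Unless \<open>x\<close> is a source, this contradicts
  the independence of \<open>w\<^sub>x\<close> from the source waves. If \<open>x\<close> is a source, the points \<open>z\<^sub>j\<close> approach
  it along a limiting direction \<open>a\<close>, so the derivative of \<open>G\<close> at \<open>x\<close> in direction \<open>a\<close> vanishes
  too, which contradicts the independence of \<open>(\<theta>\<cdot>a) w\<^sub>x(\<theta>)\<close>, as a function of \<open>\<theta>\<close>, from the
  source waves. Phrasing the argument with the functionals \<open>G\<close> avoids any bound on the
  coefficients of the combinations. The functionals exist by a finite-dimensional duality
  (\<open>separating_finite_functional\<close>).

  The functions \<open>w\<^sub>z\<close> and \<open>(x\<cdot>a) w\<^sub>z(x)\<close> are analytic, so by the hypothesis on the directions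
  their independence on \<open>{\<theta>\<^sub>n}\<close> follows from independence on the sphere
  (\<open>wave_sum_independent_on_sphere\<close>). For the latter, a relation is restricted to a great circle
  and continued to imaginary angles \<open>\<i>t\<close>. There the waves grow like \<open>exp(k b sinh t)\<close> with
  pairwise different rates \<open>b\<close> if the circle is generic, and the fastest one cannot be balanced
  by the others.

  The rest is linear algebra. Functionals dual to the source waves give a right inverse of \<open>H\<close>,
  so \<open>H\<close> has rank \<open>M\<close>. As \<open>F = -H\<^sup>* P\<^sup>-\<^sup>1 H\<close> and \<open>P\<^sup>-\<^sup>1 H\<close> is onto, \<open>F\<close> and \<open>H\<^sup>*\<close> have the
  same range. Finally, projecting onto the orthogonal complement of a subspace kills exactly the
  subspace.
\<close>

section \<open>Real-analytic functions of several variables\<close>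

lemma has_sum_prod_multi_index:
  fixes f :: "'n::finite \<Rightarrow> nat \<Rightarrow> complex"
  assumes "\<And>i. summable (\<lambda>n. norm (f i n))"
  shows "((\<lambda>\<nu>. \<Prod>i\<in>UNIV. f i (\<nu> i)) has_sum (\<Prod>i\<in>UNIV. \<Sum>n. f i n)) UNIV"
proof -
  have a: "(\<lambda>n. norm (f i n)) summable_on UNIV" for i
    using assms[of i] by (simp add: summable_on_UNIV_nonneg_real_iff)
  have "Infinite_Set_Sum.abs_summable_on (\<lambda>\<nu>. \<Prod>i\<in>UNIV. f i (\<nu> i)) (PiE UNIV (\<lambda>_. UNIV))"
    by (rule abs_summable_on_prod_PiE) (simp_all add: a[unfolded abs_summable_equivalent])
  then have s: "(\<lambda>\<nu>. \<Prod>i\<in>UNIV. f i (\<nu> i)) summable_on UNIV"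
    unfolding abs_summable_equivalent[symmetric] PiE_UNIV_domain Pi_UNIV by (rule abs_summable_summable)
  have "infsum (\<lambda>\<nu>. \<Prod>i\<in>UNIV. f i (\<nu> i)) (PiE UNIV (\<lambda>_. UNIV)) = (\<Prod>i\<in>UNIV. infsum (f i) UNIV)"
    by (rule infsum_prod_PiE_abs) (simp_all add: a)
  then have p: "infsum (\<lambda>\<nu>. \<Prod>i\<in>UNIV. f i (\<nu> i)) UNIV = (\<Prod>i\<in>UNIV. infsum (f i) UNIV)"
    by simp
  have "infsum (f i) UNIV = (\<Sum>n. f i n)" for i
    using sums_unique[OF has_sum_imp_sums[OF has_sum_infsum[OF abs_summable_summable[OF a]]]] .
  with p show ?thesis
    using has_sum_infsum[OF s] by simp
qed

text \<open>
  The exponential of a linear form is the product over the coordinates of one-variable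
  exponential series, which multiplies out to a series over multi-indices.
\<close>

lemma real_analytic_on_exp_linear:
  fixes b :: "'n::finite \<Rightarrow> complex"
  shows "real_analytic_on (\<lambda>x. exp (\<Sum>i\<in>UNIV. b i * complex_of_real (vec_nth x i))) UNIV"
  unfolding real_analytic_on_def
proof (intro conjI ballI)
  fix p :: "real^'n"
  let ?c = "\<lambda>\<nu>. exp (\<Sum>i\<in>UNIV. b i * complex_of_real (vec_nth p i)) * (\<Prod>i\<in>UNIV. b i ^ \<nu> i / fact (\<nu> i))"
  have "((\<lambda>\<nu>. ?c \<nu> * complex_of_real (monomial_at p \<nu> x)) has_sum
      exp (\<Sum>i\<in>UNIV. b i * complex_of_real (vec_nth x i))) UNIV" for x
  proof -
    let ?t = "\<lambda>i. b i * complex_of_real (vec_nth x i - vec_nth p i)"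
    let ?f = "\<lambda>i n. ?t i ^ n / fact n"
    have f: "?f i n = ?t i ^ n /\<^sub>R fact n" for i n
      by (simp add: scaleR_conv_of_real divide_inverse mult.commute)
    have "((\<lambda>\<nu>. \<Prod>i\<in>UNIV. ?f i (\<nu> i)) has_sum (\<Prod>i\<in>UNIV. \<Sum>n. ?f i n)) UNIV"
      by (rule has_sum_prod_multi_index) (unfold f, rule summable_norm_exp)
    also have "(\<Sum>n. ?f i n) = exp (?t i)" for i
      by (simp only: f exp_def)
    then have "(\<Prod>i\<in>UNIV. \<Sum>n. ?f i n) = exp (\<Sum>i\<in>UNIV. ?t i)"
      by (simp only: exp_sum finite)
    finally have "((\<lambda>\<nu>. exp (\<Sum>i\<in>UNIV. b i * complex_of_real (vec_nth p i)) * (\<Prod>i\<in>UNIV. ?f i (\<nu> i)))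
        has_sum exp (\<Sum>i\<in>UNIV. b i * complex_of_real (vec_nth p i)) * exp (\<Sum>i\<in>UNIV. ?t i)) UNIV"
      by (rule has_sum_cmult_right)
    also have "exp (\<Sum>i\<in>UNIV. b i * complex_of_real (vec_nth p i)) * exp (\<Sum>i\<in>UNIV. ?t i) =
        exp (\<Sum>i\<in>UNIV. b i * complex_of_real (vec_nth x i))"
      unfolding exp_add[symmetric] sum.distrib[symmetric] by (simp add: algebra_simps)
    also have "(\<lambda>\<nu>. exp (\<Sum>i\<in>UNIV. b i * complex_of_real (vec_nth p i)) * (\<Prod>i\<in>UNIV. ?f i (\<nu> i))) =
        (\<lambda>\<nu>. ?c \<nu> * complex_of_real (monomial_at p \<nu> x))"
    proof
      fix \<nu> :: "'n \<Rightarrow> nat"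
      have "(\<Prod>i\<in>UNIV. ?f i (\<nu> i)) =
          (\<Prod>i\<in>UNIV. b i ^ \<nu> i / fact (\<nu> i)) * (\<Prod>i\<in>UNIV. complex_of_real ((vec_nth x i - vec_nth p i) ^ \<nu> i))"
        unfolding prod.distrib[symmetric] by (intro prod.cong) (simp_all add: power_mult_distrib)
      then show "exp (\<Sum>i\<in>UNIV. b i * complex_of_real (vec_nth p i)) * (\<Prod>i\<in>UNIV. ?f i (\<nu> i)) =
          ?c \<nu> * complex_of_real (monomial_at p \<nu> x)"
        by (simp add: monomial_at_def of_real_prod mult.assoc)
    qed
    finally show ?thesis .
  qed
  then show "\<exists>r>0. \<exists>c. \<forall>x\<in>ball p r. ((\<lambda>\<nu>. c \<nu> * complex_of_real (monomial_at p \<nu> x)) has_sum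
      exp (\<Sum>i\<in>UNIV. b i * complex_of_real (vec_nth x i))) UNIV"
    by (intro exI[of _ 1] conjI exI[of _ ?c]) auto
qed auto

lemma real_analytic_on_add:
  assumes "real_analytic_on f U" "real_analytic_on g U"
  shows "real_analytic_on (\<lambda>x. f x + g x) U"
  unfolding real_analytic_on_def
proof (intro conjI ballI)
  show "open U" using assms(1) by (simp add: real_analytic_on_def)
  fix p assume "p \<in> U"
  obtain r c where 1: "r > 0"
    "\<And>x. x \<in> ball p r \<Longrightarrow> ((\<lambda>\<nu>. c \<nu> * complex_of_real (monomial_at p \<nu> x)) has_sum f x) UNIV"
    using assms(1) \<open>p \<in> U\<close> unfolding real_analytic_on_def by meson
  obtain s d where 2: "s > 0"
    "\<And>x. x \<in> ball p s \<Longrightarrow> ((\<lambda>\<nu>. d \<nu> * complex_of_real (monomial_at p \<nu> x)) has_sum g x) UNIV"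
    using assms(2) \<open>p \<in> U\<close> unfolding real_analytic_on_def by meson
  show "\<exists>r>0. \<exists>c. \<forall>x\<in>ball p r. ((\<lambda>\<nu>. c \<nu> * complex_of_real (monomial_at p \<nu> x)) has_sum f x + g x) UNIV"
    by (intro exI[of _ "min r s"] conjI exI[of _ "\<lambda>\<nu>. c \<nu> + d \<nu>"])
       (use 1 2 in \<open>auto simp: distrib_right intro!: has_sum_add\<close>)
qed

lemma real_analytic_on_cmult:
  assumes "real_analytic_on f U"
  shows "real_analytic_on (\<lambda>x. a * f x) U"
  unfolding real_analytic_on_def
proof (intro conjI ballI)
  show "open U" using assms(1) by (simp add: real_analytic_on_def)
  fix p assume "p \<in> U"
  obtain r c where 1: "r > 0"
    "\<And>x. x \<in> ball p r \<Longrightarrow> ((\<lambda>\<nu>. c \<nu> * complex_of_real (monomial_at p \<nu> x)) has_sum f x) UNIV"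
    using assms(1) \<open>p \<in> U\<close> unfolding real_analytic_on_def by meson
  show "\<exists>r>0. \<exists>c. \<forall>x\<in>ball p r. ((\<lambda>\<nu>. c \<nu> * complex_of_real (monomial_at p \<nu> x)) has_sum a * f x) UNIV"
    by (intro exI[of _ r] conjI exI[of _ "\<lambda>\<nu>. a * c \<nu>"])
       (use 1 in \<open>auto simp: mult.assoc intro!: has_sum_cmult_right\<close>)
qed

lemma real_analytic_on_sum:
  assumes "finite S" "open U" "\<And>s. s \<in> S \<Longrightarrow> real_analytic_on (f s) U"
  shows "real_analytic_on (\<lambda>x. \<Sum>s\<in>S. f s x) U"
  using assms(1,3)
proof (induction S)
  case empty
  have "\<exists>r>0. \<exists>c. \<forall>x\<in>ball p r. ((\<lambda>\<nu>. c \<nu> * complex_of_real (monomial_at p \<nu> x)) has_sum 0) UNIV" for p :: "real^'b"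
    by (intro exI[of _ 1] conjI exI[of _ "\<lambda>_. 0"]) auto
  then show ?case using \<open>open U\<close> by (auto simp: real_analytic_on_def)
next
  case (insert s S)
  then show ?case by (simp add: real_analytic_on_add)
qed

text \<open>
  Around \<open>p\<close> one has \<open>x\<^sub>i = p\<^sub>i + (x\<^sub>i - p\<^sub>i)\<close>. The constant scales the series, and the factor
  \<open>x\<^sub>i - p\<^sub>i\<close> raises the \<open>i\<close>-th entry of every multi-index by one.
\<close>

lemma real_analytic_on_coordinate_mult:
  fixes i :: "'n::finite"
  assumes "real_analytic_on f U"
  shows "real_analytic_on (\<lambda>x. complex_of_real (vec_nth x i) * f x) U"
  unfolding real_analytic_on_def
proof (intro conjI ballI)
  show "open U" using assms(1) by (simp add: real_analytic_on_def)
  fix p assume "p \<in> U"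
  obtain r c where r: "r > 0" and c:
    "\<And>x. x \<in> ball p r \<Longrightarrow> ((\<lambda>\<nu>. c \<nu> * complex_of_real (monomial_at p \<nu> x)) has_sum f x) UNIV"
    using assms(1) \<open>p \<in> U\<close> unfolding real_analytic_on_def by meson
  define up where "up = (\<lambda>\<nu> :: 'n \<Rightarrow> nat. \<nu>(i := Suc (\<nu> i)))"
  define d where "d = (\<lambda>\<nu>. if \<nu> i = 0 then 0 else c (\<nu>(i := \<nu> i - 1)))"
  have inj: "inj up"
  proof (rule injI)
    fix \<nu> \<mu> assume eq: "up \<nu> = up \<mu>"
    show "\<nu> = \<mu>"
    proof
      fix j show "\<nu> j = \<mu> j" using fun_cong[OF eq, of j] by (auto simp: up_def split: if_splits)
    qed
  qed
  have mono: "monomial_at p (up \<nu>) x = (vec_nth x i - vec_nth p i) * monomial_at p \<nu> x" for \<nu> x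
  proof -
    have "monomial_at p (up \<nu>) x = (\<Prod>j\<in>UNIV. (if j = i then vec_nth x i - vec_nth p i else 1) *
       (vec_nth x j - vec_nth p j) ^ \<nu> j)"
      unfolding monomial_at_def up_def by (intro prod.cong) auto
    then show ?thesis by (simp add: prod.distrib monomial_at_def)
  qed
  have d_up: "d (up \<nu>) = c \<nu>" for \<nu>
    by (simp add: d_def up_def)
  have out: "d \<nu> = 0" if "\<nu> \<notin> range up" for \<nu>
  proof (rule ccontr)
    assume "d \<nu> \<noteq> 0"
    then have "\<nu> i \<noteq> 0" by (metis d_def)
    then have "\<nu> = up (\<nu>(i := \<nu> i - 1))"
      by (simp add: up_def)
    with that show False by blast
  qed
  have "((\<lambda>\<nu>. (of_real (vec_nth p i) * c \<nu> + d \<nu>) * complex_of_real (monomial_at p \<nu> x)) has_sum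
      complex_of_real (vec_nth x i) * f x) UNIV" if x: "x \<in> ball p r" for x
  proof -
    have "((\<lambda>\<nu>. complex_of_real (vec_nth x i - vec_nth p i) * (c \<nu> * complex_of_real (monomial_at p \<nu> x)))
       has_sum complex_of_real (vec_nth x i - vec_nth p i) * f x) UNIV"
      by (rule has_sum_cmult_right[OF c[OF x]])
    moreover have "(\<lambda>\<nu>. complex_of_real (vec_nth x i - vec_nth p i) * (c \<nu> * complex_of_real (monomial_at p \<nu> x)))
       = (\<lambda>\<nu>. d \<nu> * complex_of_real (monomial_at p \<nu> x)) \<circ> up"
      unfolding o_def mono d_up of_real_mult by (simp only: mult_ac)
    ultimately have "((\<lambda>\<nu>. d \<nu> * complex_of_real (monomial_at p \<nu> x)) has_sum
        complex_of_real (vec_nth x i - vec_nth p i) * f x) (range up)"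
      by (simp only: has_sum_reindex[OF inj])
    also have "?this \<longleftrightarrow> ((\<lambda>\<nu>. d \<nu> * complex_of_real (monomial_at p \<nu> x)) has_sum
        complex_of_real (vec_nth x i - vec_nth p i) * f x) UNIV"
      by (rule has_sum_cong_neutral) (auto simp: out)
    finally have "((\<lambda>\<nu>. of_real (vec_nth p i) * (c \<nu> * complex_of_real (monomial_at p \<nu> x)) +
        d \<nu> * complex_of_real (monomial_at p \<nu> x)) has_sum
        of_real (vec_nth p i) * f x + complex_of_real (vec_nth x i - vec_nth p i) * f x) UNIV"
      by (intro has_sum_add has_sum_cmult_right c x)
    then
    show ?thesis by (simp add: algebra_simps)
  qed
  then show "\<exists>r>0. \<exists>c. \<forall>x\<in>ball p r. ((\<lambda>\<nu>. c \<nu> * complex_of_real (monomial_at p \<nu> x)) has_sum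
      complex_of_real (vec_nth x i) * f x) UNIV"
    using r by (intro exI[of _ r] conjI exI[of _ "\<lambda>\<nu>. of_real (vec_nth p i) * c \<nu> + d \<nu>"] ballI)
qed

lemma real_analytic_on_inner_mult:
  fixes a :: "real^'n::finite"
  assumes "real_analytic_on f U"
  shows "real_analytic_on (\<lambda>x. complex_of_real (inner x a) * f x) U"
proof -
  have "real_analytic_on (\<lambda>x. \<Sum>i\<in>UNIV. complex_of_real (vec_nth a i) * (complex_of_real (vec_nth x i) * f x)) U"
    using assms by (intro real_analytic_on_sum real_analytic_on_cmult real_analytic_on_coordinate_mult)
      (auto simp: real_analytic_on_def)
  then show ?thesis
    by (simp add: inner_vec_def sum_distrib_left sum_distrib_right mult_ac)
qed

section \<open>Independence of plane waves on the sphere\<close>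

text \<open>
  The plane wave with direction \<open>x\<close>, evaluated at \<open>-z\<close>. This is the \<open>n\<close>-th entry of \<open>\<phi>\<^sub>z\<close> for
  \<open>x = \<theta>\<^sub>n\<close>. It serves both as a function of the direction \<open>x\<close>, in questions of analyticity and
  independence, and as a function of the sampling point \<open>z\<close>, in the compactness argument.
\<close>

definition wave :: "real \<Rightarrow> real^3 \<Rightarrow> real^3 \<Rightarrow> complex" where
  "wave k z x = exp (- (\<i> * complex_of_real (k * inner x z)))"

lemma real_analytic_on_wave: "real_analytic_on (wave k z) UNIV"
proof -
  have w: "wave k z = (\<lambda>x. exp (\<Sum>i\<in>UNIV. (- \<i> * complex_of_real (k * vec_nth z i)) * complex_of_real (vec_nth x i)))"
    by (simp add: wave_def[abs_def] inner_vec_def sum_distrib_left sum_negf mult_ac)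
  show ?thesis unfolding w by (rule real_analytic_on_exp_linear)
qed

lemma analytic_on_sphere_wave_sum:
  fixes l m :: "real^3 \<Rightarrow> complex"
  assumes "finite S"
  shows "analytic_on_sphere (\<lambda>x. \<Sum>z\<in>S. (l z + m z * complex_of_real (inner x a)) * wave k z x)"
proof -
  have "real_analytic_on (\<lambda>x. \<Sum>z\<in>S. l z * wave k z x + m z * (complex_of_real (inner x a) * wave k z x)) UNIV"
    using assms by (intro real_analytic_on_sum real_analytic_on_add real_analytic_on_cmult
      real_analytic_on_inner_mult real_analytic_on_wave) auto
  then have "real_analytic_on (\<lambda>x. \<Sum>z\<in>S. (l z + m z * complex_of_real (inner x a)) * wave k z x) UNIV"
    by (simp add: algebra_simps)
  then show ?thesis unfolding analytic_on_sphere_def by blast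
qed

text \<open>
  Finitely many hyperplanes form a null set and therefore do not cover the space.
\<close>

lemma unit_vector_avoiding_hyperplanes:
  fixes W :: "'a::euclidean_space set"
  assumes "finite W" "0 \<notin> W"
  obtains e where "norm e = 1" "\<And>w. w \<in> W \<Longrightarrow> inner w e \<noteq> 0"
proof -
  obtain b :: 'a where b: "b \<in> Basis" using nonempty_Basis by blast
  \<comment> \<open>Adding a nonzero vector to \<open>W\<close> ensures that the point found can be normalised, also for empty \<open>W\<close>.\<close>
  define V where "V = insert b W"
  have "negligible (\<Union>w\<in>V. {x. inner w x = 0})"
    using assms b by (intro negligible_Union) (auto simp: V_def intro!: negligible_hyperplane)
  then have "(\<Union>w\<in>V. {x. inner w x = 0}) \<noteq> UNIV"
    using non_negligible_UNIV by metis
  then obtain x where x: "\<And>w. w \<in> V \<Longrightarrow> inner w x \<noteq> 0" by blast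
  then have "x \<noteq> 0" using b unfolding V_def by (metis inner_zero_right insertI1)
  show ?thesis
    by (rule that[of "x /\<^sub>R norm x"]) (use x \<open>x \<noteq> 0\<close> in \<open>auto simp: V_def\<close>)
qed

text \<open>
  Divide by the exponential with the largest rate \<open>b\<close> among the terms with a nonzero coefficient.
  All other terms then decay doubly exponentially, whereas their coefficients grow only
  exponentially. So the coefficient of the dominant term tends to zero, which is impossible: it is
  either a nonzero constant or, since \<open>q \<noteq> 0\<close>, unbounded.
\<close>

lemma exp_sinh_independent:
  fixes l m :: "'i \<Rightarrow> complex" and b d :: "'i \<Rightarrow> real"
  assumes S: "finite S" "inj_on b S" and k: "k > 0" and q: "q \<noteq> 0"
    and zero: "\<And>t::real. (\<Sum>z\<in>S. (l z + m z * Complex (p * cosh t) (q * sinh t)) *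
        exp (Complex (k * (b z * sinh t)) (- (k * (d z * cosh t))))) = 0"
    and z: "z \<in> S"
  shows "l z = 0 \<and> m z = 0"
proof (rule ccontr)
  assume "\<not> (l z = 0 \<and> m z = 0)"
  define T where "T = {z\<in>S. \<not> (l z = 0 \<and> m z = 0)}"
  define A where "A = (\<lambda>z t. l z + m z * Complex (p * cosh t) (q * sinh t))"
  define E where "E = (\<lambda>z t. exp (Complex (k * (b z * sinh t)) (- (k * (d z * cosh t)))))"
  have T: "finite T" "T \<noteq> {}" "T \<subseteq> S"
    using S z \<open>\<not> (l z = 0 \<and> m z = 0)\<close> by (auto simp: T_def)
  obtain z0 where z0: "z0 \<in> T" "\<And>z. z \<in> T \<Longrightarrow> b z \<le> b z0"
    using obtains_MAX[OF T(1,2), of b] T(1) by (metis Max_ge finite_imageI image_eqI)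
  have less: "b z < b z0" if "z \<in> T - {z0}" for z
    using that z0 T S(2) by (metis Diff_iff inj_on_def insertI1 order_less_le subsetD)
  have sumT: "(\<Sum>z\<in>T. A z t * E z t) = 0" for t
  proof -
    have "(\<Sum>z\<in>T. A z t * E z t) = (\<Sum>z\<in>S. A z t * E z t)"
      by (rule sum.mono_neutral_left) (use S T in \<open>auto simp: T_def A_def\<close>)
    then show ?thesis using zero[of t] by (simp add: A_def E_def)
  qed
  have small: "((\<lambda>t. A z t * (E z t / E z0 t)) \<longlongrightarrow> 0) at_top" if z: "z \<in> T - {z0}" for z
  proof (rule Lim_null_comparison)
    have "norm (A z t * (E z t / E z0 t)) \<le>
      (norm (l z) + norm (m z) * (\<bar>p\<bar> * cosh t + \<bar>q\<bar> * sinh t)) * exp (- (k * (b z0 - b z)) * sinh t)"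
      if "t \<ge> 0" for t
    proof -
      have "norm (Complex (p * cosh t) (q * sinh t)) \<le> \<bar>p * cosh t\<bar> + \<bar>q * sinh t\<bar>"
        using cmod_le[of "Complex (p * cosh t) (q * sinh t)"] by simp
      also have "\<dots> = \<bar>p\<bar> * cosh t + \<bar>q\<bar> * sinh t"
        using that by (simp add: abs_mult)
      finally have "norm (A z t) \<le> norm (l z) + norm (m z) * (\<bar>p\<bar> * cosh t + \<bar>q\<bar> * sinh t)"
        unfolding A_def by (intro order.trans[OF norm_triangle_ineq]) (simp add: norm_mult mult_left_mono)
      moreover have "norm (E z t / E z0 t) = exp (- (k * (b z0 - b z)) * sinh t)"
        by (simp add: E_def norm_divide norm_exp_eq_Re exp_diff[symmetric] algebra_simps)
      ultimately show ?thesis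
        unfolding norm_mult by (simp only:) (rule mult_right_mono, auto)
    qed
    then show "\<forall>\<^sub>F t in at_top. norm (A z t * (E z t / E z0 t)) \<le>
      (norm (l z) + norm (m z) * (\<bar>p\<bar> * cosh t + \<bar>q\<bar> * sinh t)) * exp (- (k * (b z0 - b z)) * sinh t)"
      using eventually_ge_at_top by (rule eventually_mono[rotated]) 
    define c where "c = k * (b z0 - b z)"
    have c: "c > 0" using less[OF z] k by (simp add: c_def)
    have "((\<lambda>t::real. (u + v * (p' * cosh t + q' * sinh t)) * exp (- c * sinh t)) \<longlongrightarrow> 0) at_top"
      for u v p' q' using c unfolding cosh_def sinh_def scaleR_conv_of_real by real_asymp
    then show "((\<lambda>t. (norm (l z) + norm (m z) * (\<bar>p\<bar> * cosh t + \<bar>q\<bar> * sinh t)) *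
        exp (- (k * (b z0 - b z)) * sinh t)) \<longlongrightarrow> 0) at_top"
      unfolding c_def .
  qed
  have "A z0 t = - (\<Sum>z\<in>T-{z0}. A z t * (E z t / E z0 t))" for t
  proof -
    have "A z0 t * E z0 t + (\<Sum>z\<in>T-{z0}. A z t * E z t) = 0"
      using sumT[of t] T(1) z0(1) by (simp add: sum.remove)
    then have "A z0 t = - (\<Sum>z\<in>T-{z0}. A z t * E z t) / E z0 t"
      by (simp add: E_def field_simps add_eq_0_iff)
    then show ?thesis by (simp add: sum_divide_distrib)
  qed
  moreover have "((\<lambda>t. - (\<Sum>z\<in>T-{z0}. A z t * (E z t / E z0 t))) \<longlongrightarrow> - (\<Sum>z\<in>T-{z0}. 0)) at_top"
    by (intro tendsto_minus tendsto_sum small)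
  ultimately have lim: "(A z0 \<longlongrightarrow> 0) at_top"
    by (subst tendsto_cong[where g = "\<lambda>t. - (\<Sum>z\<in>T-{z0}. A z t * (E z t / E z0 t))"]) simp_all
  show False
  proof (cases "m z0 = 0")
    case True
    then have "A z0 = (\<lambda>t. l z0)" by (simp add: A_def)
    then have "l z0 = 0" using lim by (simp add: tendsto_const_iff)
    with True z0 show False by (simp add: T_def)
  next
    case False
    have "((\<lambda>t. A z0 t - l z0) \<longlongrightarrow> 0 - l z0) at_top"
      by (intro tendsto_intros lim)
    moreover have "filterlim (\<lambda>t. A z0 t - l z0) at_infinity at_top"
    proof (rule filterlim_norm_at_top_imp_at_infinity)
      define c where "c = norm (m z0) * \<bar>q\<bar>"
      have "c > 0" using False q by (simp add: c_def)
      then have "filterlim (\<lambda>t::real. c * sinh t) at_top at_top"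
        unfolding sinh_def scaleR_conv_of_real by real_asymp
      moreover have "c * sinh t \<le> norm (A z0 t - l z0)" for t
      proof -
        have "c * sinh t \<le> norm (m z0) * \<bar>q * sinh t\<bar>"
          by (simp add: c_def abs_mult mult.assoc mult_left_mono)
        also have "\<dots> \<le> norm (m z0) * norm (Complex (p * cosh t) (q * sinh t))"
          using abs_Im_le_cmod[of "Complex (p * cosh t) (q * sinh t)"] by (intro mult_left_mono) auto
        finally show ?thesis by (simp add: A_def norm_mult)
      qed
      ultimately show "filterlim (\<lambda>t. norm (A z0 t - l z0)) at_top at_top"
        by (rule filterlim_at_top_mono[OF _ always_eventually, rule_format]) 
    qed
    ultimately show False
      using not_tendsto_and_filterlim_at_infinity[OF trivial_limit_at_top_linorder] by blast
  qed
qed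

text \<open>
  The great circle \<open>cos t e\<^sub>1 + sin t e\<^sub>2\<close> is chosen so that \<open>e\<^sub>2\<close> separates the points of \<open>S\<close> and is
  not orthogonal to \<open>a\<close>. The relation on it is entire in \<open>t\<close> and vanishes for real \<open>t\<close>, hence also
  for imaginary \<open>t\<close>, where \<open>exp_sinh_independent\<close> applies.
\<close>

lemma wave_sum_independent_on_sphere:
  fixes l m :: "real^3 \<Rightarrow> complex"
  assumes S: "finite S" and k: "k > 0" and a: "a \<noteq> 0"
    and zero: "\<And>x. x \<in> sphere 0 1 \<Longrightarrow> (\<Sum>z\<in>S. (l z + m z * complex_of_real (inner x a)) * wave k z x) = 0"
    and z: "z \<in> S"
  shows "l z = 0 \<and> m z = 0"
proof -
  define W where "W = insert a ((\<lambda>(z, w). z - w) ` (S \<times> S) - {0})"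
  have "finite W" "0 \<notin> W" using S a by (auto simp: W_def)
  then obtain e2 where e2: "norm e2 = 1" "\<And>w. w \<in> W \<Longrightarrow> inner w e2 \<noteq> 0"
    using unit_vector_avoiding_hyperplanes by blast
  have inj: "inj_on (\<lambda>z. inner z e2) S"
  proof (rule inj_onI, rule ccontr)
    fix z w assume zw: "z \<in> S" "w \<in> S" "inner z e2 = inner w e2" "z \<noteq> w"
    then have "z - w \<in> W" by (force simp: W_def)
    from e2(2)[OF this] zw show False by (simp add: inner_diff_left)
  qed
  obtain e where e: "e \<noteq> 0" "inner e2 e = 0"
    using orthogonal_to_vector_exists[of e2] unfolding real_inner_class.orthogonal_def by auto
  define e1 where "e1 = e /\<^sub>R norm e"
  have e1: "norm e1 = 1" "inner e1 e2 = 0"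
    using e by (auto simp: e1_def inner_commute)
  define g where "g = (\<lambda>t. \<Sum>z\<in>S. (l z + m z * (cos t * of_real (inner a e1) + sin t * of_real (inner a e2))) *
     exp (- (\<i> * of_real k * (cos t * of_real (inner z e1) + sin t * of_real (inner z e2)))))"
  have g_real: "g (of_real t) = 0" for t
  proof -
    define x where "x = cos t *\<^sub>R e1 + sin t *\<^sub>R e2"
    have "norm x ^ 2 = 1"
      using e1 e2(1) unfolding x_def power2_norm_eq_inner
      by (simp add: inner_add_left inner_add_right inner_commute norm_eq_1 power2_eq_square[symmetric])
    then have "x \<in> sphere 0 1" by (simp add: power2_eq_1_iff) (smt (verit) norm_ge_zero)
    from zero[OF this] show ?thesis
      by (simp add: g_def x_def wave_def inner_add_left inner_commute[of e1] inner_commute[of e2]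
          cos_of_real[symmetric] sin_of_real[symmetric] mult.assoc)
  qed
  have "g holomorphic_on UNIV"
    unfolding g_def by (intro holomorphic_intros)
  have g0: "g w = 0" for w
  proof (rule analytic_continuation[OF \<open>g holomorphic_on UNIV\<close>, of "range of_real" 0])
    show "(0::complex) islimpt range of_real"
      unfolding islimpt_approachable
    proof (intro allI impI)
      fix r :: real assume "r > 0"
      then show "\<exists>x\<in>range complex_of_real. x \<noteq> 0 \<and> dist x 0 < r"
        by (intro bexI[of _ "of_real (r/2)"] rangeI) auto
    qed
  qed (use g_real in auto)
  show ?thesis
  proof (rule exp_sinh_independent[OF S inj k])
    show "inner a e2 \<noteq> 0" using e2(2)[of a] by (simp add: W_def)
    fix t :: real
    have c: "cos (\<i> * of_real t) = of_real (cosh t)" "sin (\<i> * of_real t) = \<i> * of_real (sinh t)"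
      
      unfolding cos_i_times sin_i_times by (simp_all add: cosh_def sinh_def scaleR_conv_of_real exp_of_real[symmetric] exp_minus)
    show "(\<Sum>z\<in>S. (l z + m z * Complex (inner a e1 * cosh t) (inner a e2 * sinh t)) *
        exp (Complex (k * (inner z e2 * sinh t)) (- (k * (inner z e1 * cosh t))))) = 0"
      using g0[of "\<i> * of_real t"] unfolding g_def c
      by (simp add: Complex_eq algebra_simps)
  qed (rule z)
qed

section \<open>Separation by finitely many directions\<close>

text \<open>
  A sequence that is not a combination of finitely many given ones is separated from them by
  a functional that reads only finitely many entries. In the induction on the number of sequences,
  the new sequence \<open>f i\<close> either depends on the previous ones and imposes nothing new, or has a
  functional \<open>c0\<close> of its own by the induction hypothesis. In the latter case the induction
  hypothesis is applied to \<open>g\<close> made invisible to \<open>c0\<close>, and the functional obtained is corrected by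
  a multiple of \<open>c0\<close> so that it kills \<open>f i\<close>.
\<close>

lemma separating_finite_functional:
  fixes f :: "'i \<Rightarrow> nat \<Rightarrow> complex"
  assumes "finite S" "\<nexists>l. \<forall>n. g n = (\<Sum>i\<in>S. l i * f i n)"
  shows "\<exists>N c. (\<forall>n\<ge>N. c n = 0) \<and> (\<forall>i\<in>S. (\<Sum>n<N. c n * f i n) = 0) \<and> (\<Sum>n<N. c n * g n) = 1"
  using assms
proof (induction S arbitrary: g)
  case empty
  then obtain n0 where n0: "g n0 \<noteq> 0" by auto
  show ?case
    by (rule exI[of _ "Suc n0"], rule exI[of _ "\<lambda>n. if n = n0 then 1 / g n0 else 0"])
       (use n0 in \<open>auto simp: if_distrib[of "\<lambda>x. x * _"] sum.delta cong: if_cong\<close>)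
next
  case (insert i S)
  show ?case
  proof (cases "\<exists>l. \<forall>n. f i n = (\<Sum>j\<in>S. l j * f j n)")
    case True
    then obtain l where l: "\<And>n. f i n = (\<Sum>j\<in>S. l j * f j n)" by blast
    have "\<nexists>l. \<forall>n. g n = (\<Sum>j\<in>S. l j * f j n)"
    proof
      assume "\<exists>l. \<forall>n. g n = (\<Sum>j\<in>S. l j * f j n)"
      then obtain l' where l': "\<And>n. g n = (\<Sum>j\<in>S. l' j * f j n)" by blast
      have "g n = (\<Sum>j\<in>insert i S. (l'(i := 0)) j * f j n)" for n
        using insert.hyps unfolding l' by (auto intro!: sum.cong)
      with insert.prems show False by blast
    qed
    from insert.IH[OF this] obtain N c where c: "\<forall>n\<ge>N. c n = 0"
      "\<forall>j\<in>S. (\<Sum>n<N. c n * f j n) = 0" "(\<Sum>n<N. c n * g n) = 1" by blast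
    have "(\<Sum>n<N. c n * f i n) = (\<Sum>n<N. \<Sum>j\<in>S. l j * (c n * f j n))"
      by (simp add: l sum_distrib_left mult_ac)
    also have "\<dots> = (\<Sum>j\<in>S. l j * (\<Sum>n<N. c n * f j n))"
      by (subst sum.swap) (simp add: sum_distrib_left)
    also have "\<dots> = 0" using c(2) by simp
    finally show ?thesis using c by blast
  next
    case False
    from insert.IH[OF this] obtain N0 c0 where c0: "\<forall>n\<ge>N0. c0 n = 0"
      "\<forall>j\<in>S. (\<Sum>n<N0. c0 n * f j n) = 0" "(\<Sum>n<N0. c0 n * f i n) = 1" by blast
    define \<beta> where "\<beta> = (\<Sum>n<N0. c0 n * g n)"
    have "\<nexists>l. \<forall>n. g n - \<beta> * f i n = (\<Sum>j\<in>S. l j * f j n)"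
    proof
      assume "\<exists>l. \<forall>n. g n - \<beta> * f i n = (\<Sum>j\<in>S. l j * f j n)"
      then obtain l where l: "\<And>n. g n - \<beta> * f i n = (\<Sum>j\<in>S. l j * f j n)" by blast
      have "g n = (\<Sum>j\<in>insert i S. (l(i := \<beta>)) j * f j n)" for n
      proof -
        have "(\<Sum>j\<in>S. (l(i := \<beta>)) j * f j n) = (\<Sum>j\<in>S. l j * f j n)"
          using insert.hyps by (intro sum.cong) auto
        then show ?thesis using insert.hyps l[of n] by (simp add: algebra_simps)
      qed
      with insert.prems show False by blast
    qed
    from insert.IH[OF this] obtain N1 c1 where c1: "\<forall>n\<ge>N1. c1 n = 0"
      "\<forall>j\<in>S. (\<Sum>n<N1. c1 n * f j n) = 0" "(\<Sum>n<N1. c1 n * (g n - \<beta> * f i n)) = 1" by blast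
    define N where "N = max N0 N1"
    define \<gamma> where "\<gamma> = (\<Sum>n<N1. c1 n * f i n)"
    have ext: "(\<Sum>n<N. c0 n * h n) = (\<Sum>n<N0. c0 n * h n)" "(\<Sum>n<N. c1 n * h n) = (\<Sum>n<N1. c1 n * h n)" for h
      by (rule sum.mono_neutral_right; use c0(1) c1(1) in \<open>auto simp: N_def\<close>)+
    have pair: "(\<Sum>n<N. (c1 n - \<gamma> * c0 n) * h n) = (\<Sum>n<N1. c1 n * h n) - \<gamma> * (\<Sum>n<N0. c0 n * h n)" for h
      by (simp add: ext[symmetric] left_diff_distrib sum_subtractf sum_distrib_left mult.assoc)
    have "(\<Sum>n<N1. c1 n * g n) - \<gamma> * \<beta> = 1"
      using c1(3) by (simp add: \<gamma>_def sum_distrib_left sum_subtractf right_diff_distrib mult_ac)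
    then show ?thesis
      by (intro exI[of _ N] exI[of _ "\<lambda>n. c1 n - \<gamma> * c0 n"])
         (use c0 c1 in \<open>auto simp: pair \<gamma>_def[symmetric] \<beta>_def[symmetric]\<close>, auto simp: N_def)
  qed
qed

lemma tendsto_difference_quotient_along_direction:
  fixes f :: "'a::real_normed_vector \<Rightarrow> 'b::real_normed_vector"
  assumes f: "(f has_derivative D) (at x)"
    and z: "z \<longlonglongrightarrow> x" "\<And>n. z n \<noteq> x" "(\<lambda>n. (z n - x) /\<^sub>R norm (z n - x)) \<longlonglongrightarrow> a"
  shows "(\<lambda>n. (f (z n) - f x) /\<^sub>R norm (z n - x)) \<longlonglongrightarrow> D a"
proof -
  have lin: "bounded_linear D" using f by (rule has_derivative_bounded_linear)
  have "filterlim z (at x) sequentially"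
    using z(1,2) by (simp add: filterlim_at)
  moreover have "((\<lambda>w. (f w - f x - D (w - x)) /\<^sub>R norm (w - x)) \<longlongrightarrow> 0) (at x)"
    using f unfolding has_derivative_at_within by (simp add: divide_inverse_commute scaleR_diff_right diff_diff_eq)
  ultimately have "(\<lambda>n. (f (z n) - f x - D (z n - x)) /\<^sub>R norm (z n - x)) \<longlonglongrightarrow> 0"
    by (rule filterlim_compose[rotated])
  moreover have "(\<lambda>n. D ((z n - x) /\<^sub>R norm (z n - x))) \<longlonglongrightarrow> D a"
    by (rule bounded_linear.tendsto[OF lin z(3)])
  ultimately have "(\<lambda>n. (f (z n) - f x - D (z n - x)) /\<^sub>R norm (z n - x) + D ((z n - x) /\<^sub>R norm (z n - x))) \<longlonglongrightarrow> 0 + D a"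
    by (rule tendsto_add)
  moreover have "(f (z n) - f x - D (z n - x)) /\<^sub>R norm (z n - x) + D ((z n - x) /\<^sub>R norm (z n - x)) =
      (f (z n) - f x) /\<^sub>R norm (z n - x)" for n
    unfolding linear_cmul[OF bounded_linear.linear[OF lin]] scaleR_add_right[symmetric] by simp
  ultimately show ?thesis by simp
qed

lemma has_derivative_wave:
  "((\<lambda>z. wave k z x) has_derivative (\<lambda>h. - (\<i> * of_real k) * (of_real (inner x h) * wave k z0 x))) (at z0)"
proof -
  have "((\<lambda>z. - (\<i> * complex_of_real (k * inner x z))) has_derivative
     (\<lambda>h. - (\<i> * complex_of_real (k * inner x h)))) (at z0)"
    by (auto intro!: derivative_eq_intros)
  from has_derivative_compose[OF this DERIV_exp[unfolded has_field_derivative_def]]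
  show ?thesis
    unfolding wave_def by (simp add: mult_ac)
qed

text \<open>
  A set of points on which no nonzero function of a given space vanishes identically is called
  unisolvent for the space; here the space consists of the analytic functions on the sphere.
\<close>

locale unisolvent_directions =
  fixes k :: real and \<theta> :: "nat \<Rightarrow> real^3"
  assumes k_pos: "k > 0"
    and unisolvent: "\<And>f. \<lbrakk>analytic_on_sphere f; \<And>n. f (\<theta> n) = 0\<rbrakk> \<Longrightarrow> \<forall>x\<in>sphere 0 1. f x = 0"
begin

lemma wave_sum_independent:
  assumes "finite S" "a \<noteq> 0"
    and "\<And>n. (\<Sum>z\<in>S. (l z + m z * complex_of_real (inner (\<theta> n) a)) * wave k z (\<theta> n)) = 0"
    and "z \<in> S"
  shows "l z = 0 \<and> m z = 0"
  using unisolvent[OF analytic_on_sphere_wave_sum[OF assms(1), of l m a k] assms(3)]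
  by (intro wave_sum_independent_on_sphere[OF assms(1) k_pos assms(2) _ assms(4)]) blast

text \<open>
  This and the next lemma are the two instances of independence needed below: a point away from the
  sources, and an infinitesimal displacement of a source.
\<close>

lemma wave_not_in_span:
  assumes "finite Y" "z \<notin> Y"
  shows "\<nexists>l. \<forall>n. wave k z (\<theta> n) = (\<Sum>y\<in>Y. l y * wave k y (\<theta> n))"
proof
  assume "\<exists>l. \<forall>n. wave k z (\<theta> n) = (\<Sum>y\<in>Y. l y * wave k y (\<theta> n))"
  then obtain l where l: "\<And>n. wave k z (\<theta> n) = (\<Sum>y\<in>Y. l y * wave k y (\<theta> n))" by blast
  obtain a :: "real^3" where "a \<noteq> 0" using nonzero_Basis by blast
  have "(l(z := -1)) z = 0 \<and> (0::complex) = 0"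
  proof (rule wave_sum_independent[where S = "insert z Y" and a = a and l = "l(z := -1)" and m = "\<lambda>_. 0"])
    fix n
    have "(\<Sum>y\<in>Y. (l(z := -1)) y * wave k y (\<theta> n)) = (\<Sum>y\<in>Y. l y * wave k y (\<theta> n))"
      using assms by (intro sum.cong) auto
    then show "(\<Sum>y\<in>insert z Y. ((l(z := -1)) y + 0 * complex_of_real (inner (\<theta> n) a)) * wave k y (\<theta> n)) = 0"
      using assms by (simp add: l)
  qed (use assms \<open>a \<noteq> 0\<close> in auto)
  then show False by simp
qed

lemma wave_derivative_not_in_span:
  assumes "finite Y" "z \<in> Y" "a \<noteq> 0"
  shows "\<nexists>l. \<forall>n. complex_of_real (inner (\<theta> n) a) * wave k z (\<theta> n) = (\<Sum>y\<in>Y. l y * wave k y (\<theta> n))"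
proof
  assume "\<exists>l. \<forall>n. complex_of_real (inner (\<theta> n) a) * wave k z (\<theta> n) = (\<Sum>y\<in>Y. l y * wave k y (\<theta> n))"
  then obtain l where l: "\<And>n. complex_of_real (inner (\<theta> n) a) * wave k z (\<theta> n) = (\<Sum>y\<in>Y. l y * wave k y (\<theta> n))"
    by blast
  have "- l z = 0 \<and> (if z = z then 1 else 0) = (0::complex)"
  proof (rule wave_sum_independent[where S = Y and a = a and l = "\<lambda>y. - l y" and m = "\<lambda>y. if y = z then 1 else 0"])
    fix n
    have "(\<Sum>y\<in>Y. (- l y + (if y = z then 1 else 0) * complex_of_real (inner (\<theta> n) a)) * wave k y (\<theta> n)) =
       - (\<Sum>y\<in>Y. l y * wave k y (\<theta> n)) +
       (\<Sum>y\<in>Y. if y = z then complex_of_real (inner (\<theta> n) a) * wave k y (\<theta> n) else 0)"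
      unfolding sum_negf[symmetric] sum.distrib[symmetric] by (intro sum.cong) (auto simp: algebra_simps)
    also have "\<dots> = 0" using assms by (simp add: l[symmetric])
    finally show "(\<Sum>y\<in>Y. (- l y + (if y = z then 1 else 0) * complex_of_real (inner (\<theta> n) a)) * wave k y (\<theta> n)) = 0" .
  qed (use assms in auto)
  then show False by simp
qed

text \<open>
  Argue by contradiction with a sequence of counterexamples. Its limit points can be neither outside \<open>Y\<close>
  nor, by considering the direction of approach, in \<open>Y\<close>.
\<close>

lemma eventually_only_sources_in_span:
  assumes Y: "finite Y" and K: "compact K"
  shows "\<exists>N0. \<forall>N\<ge>N0. \<forall>z\<in>K. (\<exists>l. \<forall>n<N. wave k z (\<theta> n) = (\<Sum>y\<in>Y. l y * wave k y (\<theta> n))) \<longrightarrow> z \<in> Y"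
proof (rule ccontr)
  assume "\<not> ?thesis"
  then have "\<forall>N0. \<exists>z. z \<in> K \<and> z \<notin> Y \<and> (\<exists>l. \<forall>n<N0. wave k z (\<theta> n) = (\<Sum>y\<in>Y. l y * wave k y (\<theta> n)))"
    by (meson order_less_le_trans)
  then obtain z where zK: "\<And>j. z j \<in> K" and zY: "\<And>j. z j \<notin> Y"
    and zl: "\<And>j. \<exists>l. \<forall>n<j. wave k (z j) (\<theta> n) = (\<Sum>y\<in>Y. l y * wave k y (\<theta> n))"
    by metis
  define G where "G = (\<lambda>N c w. \<Sum>n<N. c n * wave k w (\<theta> n))"
  \<comment> \<open>A functional that vanishes on \<open>Y\<close> cannot tell the \<open>z j\<close> with large \<open>j\<close> from points of \<open>Y\<close>.\<close>
  have kill: "G N c (z j) = 0" if "\<forall>y\<in>Y. G N c y = 0" "N \<le> j" for N c j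
  proof -
    obtain l where l: "\<And>n. n < j \<Longrightarrow> wave k (z j) (\<theta> n) = (\<Sum>y\<in>Y. l y * wave k y (\<theta> n))"
      using zl by blast
    have "G N c (z j) = (\<Sum>n<N. \<Sum>y\<in>Y. l y * (c n * wave k y (\<theta> n)))"
      unfolding G_def by (intro sum.cong refl) (use l that(2) in \<open>simp add: sum_distrib_left mult_ac\<close>)
    also have "\<dots> = (\<Sum>y\<in>Y. l y * G N c y)"
      by (subst sum.swap) (simp add: sum_distrib_left G_def)
    finally show ?thesis using that by simp
  qed
  have deriv: "(G N c has_derivative (\<lambda>h. - (\<i> * of_real k) * (\<Sum>n<N. c n * (of_real (inner (\<theta> n) h) * wave k w (\<theta> n))))) (at w)"
    for N c w
  proof -
    have "(G N c has_derivative (\<lambda>h. \<Sum>n<N. c n * (- (\<i> * of_real k) * (of_real (inner (\<theta> n) h) * wave k w (\<theta> n))))) (at w)"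
      unfolding G_def by (intro has_derivative_sum has_derivative_mult_right has_derivative_wave)
    then show ?thesis by (simp add: sum_distrib_left mult_ac)
  qed
  obtain x r where x: "x \<in> K" "strict_mono r" "(z \<circ> r) \<longlonglongrightarrow> x"
    using K zK unfolding compact_def by metis
  have xY: "x \<in> Y"
  proof (rule ccontr)
    assume "x \<notin> Y"
    from separating_finite_functional[OF Y wave_not_in_span[OF Y this]]
    obtain N c where c: "\<forall>y\<in>Y. G N c y = 0" "G N c x = 1" unfolding G_def by blast
    have "(\<lambda>j. G N c ((z \<circ> r) j)) \<longlonglongrightarrow> G N c x"
      by (rule isCont_tendsto_compose[OF has_derivative_continuous[OF deriv] x(3)])
    moreover have "\<forall>\<^sub>F j in sequentially. G N c ((z \<circ> r) j) = 0"
      using eventually_ge_at_top[of N]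
    proof eventually_elim
      case (elim j)
      then have "N \<le> r j" using seq_suble[OF x(2)] order.trans by metis
      then show ?case using kill[OF c(1)] by simp
    qed
    ultimately have "G N c x = 0"
      by (rule LIMSEQ_unique[OF _ tendsto_eventually])
    with c(2) show False by simp
  qed
  \<comment> \<open>Approaching \<open>x\<close> along a limiting direction \<open>a\<close> turns equal values into a vanishing derivative.\<close>
  define u where "u = (\<lambda>j. (z (r j) - x) /\<^sub>R norm (z (r j) - x))"
  have ne: "z j \<noteq> x" for j using xY zY by metis
  then have "\<forall>j. u j \<in> sphere 0 1" by (simp add: u_def)
  then obtain a s where a: "a \<in> sphere 0 1" "strict_mono s" "(u \<circ> s) \<longlonglongrightarrow> a"
    using compact_sphere unfolding compact_def by metis
  then have "a \<noteq> 0" by auto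
  from separating_finite_functional[OF Y wave_derivative_not_in_span[OF Y xY this]]
  obtain N c where c: "\<forall>y\<in>Y. G N c y = 0" "(\<Sum>n<N. c n * (of_real (inner (\<theta> n) a) * wave k x (\<theta> n))) = 1"
    unfolding G_def by blast
  have "(\<lambda>j. (G N c (z (r (s j))) - G N c x) /\<^sub>R norm (z (r (s j)) - x)) \<longlonglongrightarrow>
      - (\<i> * of_real k) * (\<Sum>n<N. c n * (of_real (inner (\<theta> n) a) * wave k x (\<theta> n)))"
    by (rule tendsto_difference_quotient_along_direction[OF deriv])
       (use ne a(3) LIMSEQ_subseq_LIMSEQ[OF x(3) a(2)] in \<open>auto simp: u_def o_def\<close>)
  moreover have "\<forall>\<^sub>F j in sequentially. (G N c (z (r (s j))) - G N c x) /\<^sub>R norm (z (r (s j)) - x) = 0"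
    using eventually_ge_at_top[of N]
  proof eventually_elim
    case (elim j)
    then have "N \<le> r (s j)" using seq_suble[OF x(2)] seq_suble[OF a(2)] order.trans by metis
    then show ?case using kill[OF c(1), of "r (s j)"] c(1) xY by simp
  qed
  ultimately have "- (\<i> * complex_of_real k) * (\<Sum>n<N. c n * (of_real (inner (\<theta> n) a) * wave k x (\<theta> n))) = 0"
    by (rule LIMSEQ_unique[OF _ tendsto_eventually])
  with c(2) k_pos show False by simp
qed

text \<open>
  The functionals dual to the waves of \<open>Y\<close>; conjugated, they are the columns of a right inverse of \<open>H\<close>.
\<close>

lemma eventually_dual_basis:
  assumes Y: "finite Y"
  shows "\<exists>N0 C. \<forall>N\<ge>N0. \<forall>x\<in>Y. \<forall>y\<in>Y. (\<Sum>n<N. C x n * wave k y (\<theta> n)) = (if x = y then 1 else 0)"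
proof -
  have "\<exists>N c. (\<forall>n\<ge>N. c n = 0) \<and> (\<forall>y\<in>Y - {x}. (\<Sum>n<N. c n * wave k y (\<theta> n)) = 0) \<and> (\<Sum>n<N. c n * wave k x (\<theta> n)) = 1" for x
    by (rule separating_finite_functional[OF _ wave_not_in_span]) (use Y in auto)
  then obtain B C where C: "\<And>x. (\<forall>n\<ge>B x. C x n = 0) \<and>
      (\<forall>y\<in>Y - {x}. (\<Sum>n<B x. C x n * wave k y (\<theta> n)) = 0) \<and> (\<Sum>n<B x. C x n * wave k x (\<theta> n)) = 1"
    by metis
  have "(\<Sum>n<N. C x n * wave k y (\<theta> n)) = (if x = y then 1 else 0)"
    if "N \<ge> Max (B ` Y)" "x \<in> Y" "y \<in> Y" for N x y
  proof -
    have "B x \<le> Max (B ` Y)" using Y that(2) by (intro Max_ge) auto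
    then have "B x \<le> N" using that(1) by simp
    then have "(\<Sum>n<N. C x n * wave k y (\<theta> n)) = (\<Sum>n<B x. C x n * wave k y (\<theta> n))"
      using C[of x] by (intro sum.mono_neutral_right) auto
    then show ?thesis using C[of x] that by auto
  qed
  then have "\<forall>N\<ge>Max (B ` Y). \<forall>x\<in>Y. \<forall>y\<in>Y. (\<Sum>n<N. C x n * wave k y (\<theta> n)) = (if x = y then 1 else 0)"
    by (intro allI impI ballI)
  then show ?thesis by (intro exI)
qed

end

section \<open>Ranges of adjoints and orthogonal projections\<close>

lemma conjugate_complex_eq_cnj: "conjugate = cnj"
  by (rule ext) (simp add: conjugate_complex_def)

lemma mat_adjoint_carrier: "A \<in> carrier_mat m n \<Longrightarrow> mat_adjoint A \<in> carrier_mat n m"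
  by (auto simp: mat_adjoint_def mat_of_rows_def)

lemma mat_adjoint_index:
  fixes A :: "complex mat"
  assumes "A \<in> carrier_mat m n" "i < n" "j < m"
  shows "mat_adjoint A $$ (i, j) = cnj (A $$ (j, i))"
  using assms by (auto simp: mat_adjoint_def mat_of_rows_def conjugate_complex_eq_cnj)

lemma cscalar_prod_sum:
  fixes v w :: "complex vec"
  assumes "w \<in> carrier_vec n"
  shows "v \<bullet>c w = (\<Sum>i<n. v $ i * cnj (w $ i))"
  using assms by (auto simp: scalar_prod_def conjugate_complex_eq_cnj lessThan_atLeast0)

lemma cscalar_prod_commute:
  fixes v w :: "complex vec"
  assumes "v \<in> carrier_vec n" "w \<in> carrier_vec n"
  shows "w \<bullet>c v = cnj (v \<bullet>c w)"
  by (simp add: cscalar_prod_sum[OF assms(1)] cscalar_prod_sum[OF assms(2)] mult.commute)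

lemma cscalar_prod_mat_adjoint:
  fixes A :: "complex mat"
  assumes A: "A \<in> carrier_mat m n" and u: "u \<in> carrier_vec n" and w: "w \<in> carrier_vec m"
  shows "u \<bullet>c (mat_adjoint A *\<^sub>v w) = (A *\<^sub>v u) \<bullet>c w"
proof -
  have "mat_adjoint A *\<^sub>v w \<in> carrier_vec n"
    using mat_adjoint_carrier[OF A] w by simp
  then have "u \<bullet>c (mat_adjoint A *\<^sub>v w) = (\<Sum>i<n. \<Sum>j<m. u $ i * (A $$ (j, i) * cnj (w $ j)))"
    using mat_adjoint_carrier[OF A] w
    by (simp add: cscalar_prod_sum scalar_prod_def lessThan_atLeast0 sum_distrib_left mat_adjoint_index[OF A])
  also have "\<dots> = (\<Sum>j<m. \<Sum>i<n. u $ i * (A $$ (j, i) * cnj (w $ j)))"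
    by (rule sum.swap)
  also have "\<dots> = (A *\<^sub>v u) \<bullet>c w"
    using A u w
    by (simp add: cscalar_prod_sum[OF w] scalar_prod_def lessThan_atLeast0 sum_distrib_left mult_ac)
  finally show ?thesis .
qed

lemma rank_eq_if_right_inverse:
  fixes A C :: "complex mat"
  assumes A: "A \<in> carrier_mat m n" and C: "C \<in> carrier_mat n m" and AC: "A * C = 1\<^sub>m m"
  shows "vec_space.rank m A = m"
proof -
  interpret vec_space "TYPE(complex)" m .
  have "v \<in> col_space A" if v: "v \<in> carrier_vec m" for v
  proof -
    have "A *\<^sub>v (C *\<^sub>v v) = v"
      using assoc_mult_mat_vec[OF A C v] AC v by simp
    then show ?thesis using A C v unfolding col_space_eq[OF A] by auto
  qed
  moreover have "col_space A \<subseteq> carrier_vec m" unfolding col_space_eq[OF A] using A by auto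
  ultimately have "span (set (cols A)) = carrier_vec m" unfolding col_space_def by blast
  then have "span_vs (set (cols A)) = V" by simp
  then show ?thesis unfolding rank_def using dim_is_n by simp
qed

text \<open>
  A right inverse \<open>C\<close> of \<open>A\<close> makes \<open>A\<^sup>*\<close> injective, hence \<open>A A\<^sup>*\<close> invertible, and the component of \<open>v\<close>
  in the range of \<open>A\<^sup>*\<close> is \<open>A\<^sup>* (A A\<^sup>*)\<^sup>-\<^sup>1 A v\<close>.
\<close>

lemma orthogonal_decomposition_range_adjoint:
  fixes A C :: "complex mat"
  assumes A: "A \<in> carrier_mat m n" and C: "C \<in> carrier_mat n m" and AC: "A * C = 1\<^sub>m m"
    and v: "v \<in> carrier_vec n"
  obtains r where "r \<in> mat_range (mat_adjoint A)" "v - r \<in> orth_compl n (mat_range (mat_adjoint A))"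
proof -
  let ?B = "mat_adjoint A"
  have B: "?B \<in> carrier_mat n m" by (rule mat_adjoint_carrier[OF A])
  have AB: "A * ?B \<in> carrier_mat m m" using A B by simp
  have "det (A * ?B) \<noteq> 0"
  proof
    assume "det (A * ?B) = 0"
    then obtain w where w: "w \<in> carrier_vec m" "w \<noteq> 0\<^sub>v m" "(A * ?B) *\<^sub>v w = 0\<^sub>v m"
      using det_0_iff_vec_prod_zero_field[OF AB] by blast
    have Bw: "?B *\<^sub>v w \<in> carrier_vec n" using B w by simp
    have "(?B *\<^sub>v w) \<bullet>c (?B *\<^sub>v w) = (A *\<^sub>v (?B *\<^sub>v w)) \<bullet>c w"
      by (rule cscalar_prod_mat_adjoint[OF A Bw w(1)])
    also have "\<dots> = 0" using w assoc_mult_mat_vec[OF A B w(1)] by (simp add: cscalar_prod_sum[OF w(1)])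
    finally have Bw0: "?B *\<^sub>v w = 0\<^sub>v n" using conjugate_square_eq_0_vec[OF Bw] by simp
    have Cw: "C *\<^sub>v w \<in> carrier_vec n" using C w by simp
    have "w \<bullet>c w = (A *\<^sub>v (C *\<^sub>v w)) \<bullet>c w" using assoc_mult_mat_vec[OF A C w(1)] AC w by simp
    also have "\<dots> = (C *\<^sub>v w) \<bullet>c (?B *\<^sub>v w)" by (rule cscalar_prod_mat_adjoint[OF A Cw w(1), symmetric])
    also have "\<dots> = 0" unfolding Bw0 using Cw by simp
    finally show False using w conjugate_square_eq_0_vec[OF w(1)] by simp
  qed
  from det_non_zero_imp_unit[OF AB this, of "()"]
  obtain T where T: "T \<in> carrier_mat m m" "(A * ?B) * T = 1\<^sub>m m"
    by (auto simp: Units_def ring_mat_def)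
  define t where "t = T *\<^sub>v (A *\<^sub>v v)"
  have t: "t \<in> carrier_vec m" using T A v by (simp add: t_def)
  have Av: "A *\<^sub>v v \<in> carrier_vec m" using A v by simp
  have "A *\<^sub>v (?B *\<^sub>v t) = (A * ?B * T) *\<^sub>v (A *\<^sub>v v)"
    using assoc_mult_mat_vec[OF A B t] assoc_mult_mat_vec[OF AB T(1) Av] by (simp add: t_def)
  also have "\<dots> = A *\<^sub>v v" using T(2) Av by simp
  finally have "A *\<^sub>v (?B *\<^sub>v t) = A *\<^sub>v v" .
  then have A0: "A *\<^sub>v (v - ?B *\<^sub>v t) = 0\<^sub>v m"
    using mult_minus_distrib_mat_vec[OF A v, of "?B *\<^sub>v t"] A B t v by simp
  show thesis
  proof
    show "?B *\<^sub>v t \<in> mat_range ?B" using B t by (auto simp: mat_range_def)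
    have p: "v - ?B *\<^sub>v t \<in> carrier_vec n" using v B t by simp
    have "(v - ?B *\<^sub>v t) \<bullet>c (?B *\<^sub>v w) = 0" if "w \<in> carrier_vec m" for w
      unfolding cscalar_prod_mat_adjoint[OF A p that] A0 using that by (simp add: cscalar_prod_sum[of _ m])
    then show "v - ?B *\<^sub>v t \<in> orth_compl n (mat_range ?B)"
      using p B by (auto simp: orth_compl_def mat_range_def)
  qed
qed

text \<open>
  The decomposition \<open>v = (v - r) + r\<close> with \<open>r \<in> R\<close> and \<open>v - r \<bottom> R\<close> supplies the existence that the
  definite description in \<open>orth_proj\<close> relies on: the projection of \<open>v\<close> onto the complement of \<open>R\<close>
  is \<open>v - r\<close>.
\<close>

lemma orth_proj_orth_compl_eq_0_iff:
  assumes R: "R \<subseteq> carrier_vec n" and v: "v \<in> carrier_vec n"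
    and r: "r \<in> R" "v - r \<in> orth_compl n R"
  shows "orth_proj n (orth_compl n R) v = 0\<^sub>v n \<longleftrightarrow> v \<in> R"
proof -
  define p where "p = v - r"
  have rc: "r \<in> carrier_vec n" using r R by auto
  have pc: "p \<in> carrier_vec n" and p: "p \<in> orth_compl n R" using r by (auto simp: p_def orth_compl_def)
  have pW: "x \<bullet>c p = 0" if "x \<in> R" for x
    using p that R cscalar_prod_commute[of p n x] pc by (auto simp: orth_compl_def)
  have vp: "v - p = r" using v rc by (auto simp: p_def)
  have rW: "v - p \<in> orth_compl n (orth_compl n R)"
    unfolding vp orth_compl_def
  proof (intro CollectI conjI ballI rc)
    fix w assume "w \<in> {v \<in> carrier_vec n. \<forall>w\<in>R. v \<bullet>c w = 0}"
    then show "r \<bullet>c w = 0" using cscalar_prod_commute[of w n r] rc r(1) by auto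
  qed
  have uniq: "q = p" if q: "q \<in> orth_compl n R" "v - q \<in> orth_compl n (orth_compl n R)" for q
  proof -
    have qc: "q \<in> carrier_vec n" using q by (auto simp: orth_compl_def)
    have eq: "q \<bullet>c x = p \<bullet>c x" if x: "x \<in> orth_compl n R" for x
    proof -
      have xc: "conjugate x \<in> carrier_vec n" using x by (auto simp: orth_compl_def)
      have "(v - q) \<bullet>c x = 0" "(v - p) \<bullet>c x = 0" using q(2) rW x by (auto simp: orth_compl_def)
      then show ?thesis
        using minus_scalar_prod_distrib[OF v qc xc] minus_scalar_prod_distrib[OF v pc xc] by simp
    qed
    have cc: "conjugate x \<in> carrier_vec n" if "x \<in> carrier_vec n" for x :: "complex vec" using that by simp
    have d: "q - p \<in> carrier_vec n" using qc pc by simp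
    have "(q - p) \<bullet>c q = 0" "(q - p) \<bullet>c p = 0"
      using eq[OF q(1)] eq[OF p] minus_scalar_prod_distrib[OF qc pc cc[OF qc]]
        minus_scalar_prod_distrib[OF qc pc cc[OF pc]] by simp_all
    then have "(q - p) \<bullet>c (q - p) = 0"
      using qc pc by (simp add: cscalar_prod_sum[of _ n] right_diff_distrib sum_subtractf)
    then have "q - p = 0\<^sub>v n" using conjugate_square_eq_0_vec[OF d] by simp
    then have "(q - p) $ i = 0" if "i < n" for i using that by simp
    then show ?thesis using qc pc by (intro eq_vecI) auto
  qed
  have proj: "orth_proj n (orth_compl n R) v = p"
    unfolding orth_proj_def by (rule the_equality) (use p rW in blast, use uniq in blast)
  show ?thesis
  proof
    assume "orth_proj n (orth_compl n R) v = 0\<^sub>v n"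
    then have "v - 0\<^sub>v n = r" using vp proj by simp
    then show "v \<in> R" using r v by simp
  next
    assume "v \<in> R"
    have "p \<bullet>c p = v \<bullet>c p - r \<bullet>c p"
      unfolding p_def by (rule minus_scalar_prod_distrib) (use v rc in auto)
    also have "\<dots> = 0" using pW[OF \<open>v \<in> R\<close>] pW[OF r(1)] by simp
    finally show "orth_proj n (orth_compl n R) v = 0\<^sub>v n"
      unfolding proj using conjugate_square_eq_0_vec[OF pc] by simp
  qed
qed

text \<open>
  The right factor \<open>Q H\<close> is onto, with right inverse \<open>C P\<close>, and the sign does not change the range.
\<close>

lemma mat_range_eq_left_factor:
  fixes A C Q P H :: "complex mat"
  assumes A: "A \<in> carrier_mat n m" and H: "H \<in> carrier_mat m n" and C: "C \<in> carrier_mat n m"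
    and Q: "Q \<in> carrier_mat m m" and P: "P \<in> carrier_mat m m"
    and HC: "H * C = 1\<^sub>m m" and QP: "Q * P = 1\<^sub>m m"
  shows "mat_range (- (A * (Q * H))) = mat_range A"
proof
  have QH: "Q * H \<in> carrier_mat m n" using Q H by simp
  have eq: "(- (A * (Q * H))) *\<^sub>v v = A *\<^sub>v (- (Q *\<^sub>v (H *\<^sub>v v)))" if v: "v \<in> carrier_vec n" for v
  proof -
    have x: "Q *\<^sub>v (H *\<^sub>v v) \<in> carrier_vec m" using Q H v by simp
    have "(- (A * (Q * H))) *\<^sub>v v = - (A * (Q * H) *\<^sub>v v)"
      by (rule uminus_mult_mat_vec) (use H v in simp)
    also have "A * (Q * H) *\<^sub>v v = A *\<^sub>v (Q *\<^sub>v (H *\<^sub>v v))"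
      unfolding assoc_mult_mat_vec[OF A QH v] assoc_mult_mat_vec[OF Q H v] ..
    also have "- (A *\<^sub>v (Q *\<^sub>v (H *\<^sub>v v))) = A *\<^sub>v (- (Q *\<^sub>v (H *\<^sub>v v)))"
      using A Q x by (intro eq_vecI) auto
    finally show ?thesis .
  qed
  show "mat_range (- (A * (Q * H))) \<subseteq> mat_range A"
  proof
    fix x assume "x \<in> mat_range (- (A * (Q * H)))"
    then obtain v where "v \<in> carrier_vec (dim_col (- (A * (Q * H))))" and x: "x = (- (A * (Q * H))) *\<^sub>v v"
      unfolding mat_range_def by (rule imageE)
    with H have v: "v \<in> carrier_vec n" by simp
    have "- (Q *\<^sub>v (H *\<^sub>v v)) \<in> carrier_vec m" using Q H v by simp
    then show "x \<in> mat_range A"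
      unfolding x eq[OF v] mat_range_def using A by (intro imageI) simp
  qed
  show "mat_range A \<subseteq> mat_range (- (A * (Q * H)))"
  proof
    fix x assume "x \<in> mat_range A"
    then obtain w where "w \<in> carrier_vec (dim_col A)" and x: "x = A *\<^sub>v w"
      unfolding mat_range_def by (rule imageE)
    with A have w: "w \<in> carrier_vec m" by simp
    define u where "u = P *\<^sub>v (- w)"
    have u: "u \<in> carrier_vec m" using P w by (simp add: u_def)
    have Cu: "C *\<^sub>v u \<in> carrier_vec n" using C u by simp
    have HCu: "H *\<^sub>v (C *\<^sub>v u) = u" using assoc_mult_mat_vec[OF H C u] HC u by simp
    have Qu: "Q *\<^sub>v u = - w" unfolding u_def using assoc_mult_mat_vec[OF Q P, of "- w"] QP w by simp
    have "x = (- (A * (Q * H))) *\<^sub>v (C *\<^sub>v u)"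
      unfolding eq[OF Cu] HCu Qu x by simp
    moreover have "C *\<^sub>v u \<in> carrier_vec (dim_col (- (A * (Q * H))))"
      using Cu H by simp
    ultimately show "x \<in> mat_range (- (A * (Q * H)))"
      unfolding mat_range_def by (rule image_eqI)
  qed
qed

lemma invertible_mat_imp_mat_inverse:
  fixes P :: "complex mat"
  assumes "invertible_mat P" "P \<in> carrier_mat n n"
  obtains Q where "mat_inverse P = Some Q" "Q \<in> carrier_mat n n" "Q * P = 1\<^sub>m n"
proof -
  obtain B where inv: "inverts_mat P B" "inverts_mat B P"
    using assms(1) unfolding invertible_mat_def by blast
  have B: "P * B = 1\<^sub>m n" "B * P = 1\<^sub>m (dim_row B)"
    using inv assms(2) by (simp_all add: inverts_mat_def)
  have "dim_col B = n" using arg_cong[OF B(1), of dim_col] by simp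
  moreover have "dim_row B = n" using arg_cong[OF B(2), of dim_col] assms by simp
  ultimately have "B \<in> carrier_mat n n" "B * P = 1\<^sub>m n" using B by auto
  then have "P \<in> Units (ring_mat TYPE(complex) n ())"
    using B(1) assms(2) unfolding Units_def ring_mat_def by auto
  then have "mat_inverse P \<noteq> None" using mat_inverse(1)[OF assms(2), where b = "()"] by auto
  then show thesis using that mat_inverse(2)[OF assms(2)] by auto
qed

section \<open>The range test for point scatterers\<close>

lemma H_mat_carrier: "H_mat M y k \<theta> N \<in> carrier_mat M N"
  by (simp add: H_mat_def)

lemma mat_adjoint_H_mat_index:
  "n < N \<Longrightarrow> m < M \<Longrightarrow> mat_adjoint (H_mat M y k \<theta> N) $$ (n, m) = wave k (y m) (\<theta> n)"
  by (simp add: mat_adjoint_index[OF H_mat_carrier]) (simp add: H_mat_def wave_def exp_cnj inner_commute)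

lemma phi_vec_wave: "phi_vec k \<theta> N z = vec N (\<lambda>n. wave k z (\<theta> n))"
  by (simp add: phi_vec_def wave_def)

lemma mult_mat_adjoint_H_mat:
  assumes "v \<in> carrier_vec M"
  shows "mat_adjoint (H_mat M y k \<theta> N) *\<^sub>v v = vec N (\<lambda>n. \<Sum>m<M. v $ m * wave k (y m) (\<theta> n))"
proof -
  note B = mat_adjoint_carrier[OF H_mat_carrier, of M y k \<theta> N]
  show ?thesis
    by (rule eq_vecI) (use B assms in \<open>auto simp: scalar_prod_def lessThan_atLeast0 mat_adjoint_H_mat_index mult.commute\<close>)
qed

lemma phi_vec_in_range_H_iff:
  assumes "inj_on y {..<M}"
  shows "phi_vec k \<theta> N z \<in> mat_range (mat_adjoint (H_mat M y k \<theta> N)) \<longleftrightarrow>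
    (\<exists>l. \<forall>n<N. wave k z (\<theta> n) = (\<Sum>x\<in>y ` {..<M}. l x * wave k x (\<theta> n)))"
proof
  assume "phi_vec k \<theta> N z \<in> mat_range (mat_adjoint (H_mat M y k \<theta> N))"
  then obtain v where v: "v \<in> carrier_vec M" "phi_vec k \<theta> N z = mat_adjoint (H_mat M y k \<theta> N) *\<^sub>v v"
    using mat_adjoint_carrier[OF H_mat_carrier, of M y k \<theta> N] by (auto simp: mat_range_def)
  have "wave k z (\<theta> n) = (\<Sum>x\<in>y ` {..<M}. v $ (the_inv_into {..<M} y x) * wave k x (\<theta> n))" if "n < N" for n
  proof -
    have "wave k z (\<theta> n) = (\<Sum>m<M. v $ m * wave k (y m) (\<theta> n))"
      using arg_cong[OF v(2), of "\<lambda>u. vec_index u n"] that v(1) by (simp add: phi_vec_wave mult_mat_adjoint_H_mat)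
    then show ?thesis by (simp add: sum.reindex[OF assms] the_inv_into_f_f[OF assms])
  qed
  then show "\<exists>l. \<forall>n<N. wave k z (\<theta> n) = (\<Sum>x\<in>y ` {..<M}. l x * wave k x (\<theta> n))"
    by (intro exI[of _ "\<lambda>x. v $ (the_inv_into {..<M} y x)"] allI impI)
next
  assume "\<exists>l. \<forall>n<N. wave k z (\<theta> n) = (\<Sum>x\<in>y ` {..<M}. l x * wave k x (\<theta> n))"
  then obtain l where l: "\<forall>n<N. wave k z (\<theta> n) = (\<Sum>x\<in>y ` {..<M}. l x * wave k x (\<theta> n))" ..
  have "phi_vec k \<theta> N z = mat_adjoint (H_mat M y k \<theta> N) *\<^sub>v vec M (\<lambda>m. l (y m))"
    unfolding phi_vec_wave mult_mat_adjoint_H_mat[OF vec_carrier]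
    by (rule eq_vecI) (simp_all add: l[rule_format] sum.reindex[OF assms])
  then show "phi_vec k \<theta> N z \<in> mat_range (mat_adjoint (H_mat M y k \<theta> N))"
    using mat_adjoint_carrier[OF H_mat_carrier, of M y k \<theta> N] by (auto simp: mat_range_def)
qed

text \<open>
  The exponential in the far field factors into a wave of the observation direction and a wave of the
  incident direction.
\<close>

lemma F_mat_factorization:
  assumes Q: "mat_inverse (P_mat M y k \<alpha>) = Some Q" "Q \<in> carrier_mat M M"
  shows "F_mat M y k \<alpha> \<theta> N = - (mat_adjoint (H_mat M y k \<theta> N) * (Q * H_mat M y k \<theta> N))"
proof -
  let ?H = "H_mat M y k \<theta> N"
  note H = H_mat_carrier[of M y k \<theta> N] and B = mat_adjoint_carrier[OF H_mat_carrier, of M y k \<theta> N]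
  show ?thesis
  proof (rule eq_matI)
    fix i j assume "i < dim_row (- (mat_adjoint ?H * (Q * ?H)))" "j < dim_col (- (mat_adjoint ?H * (Q * ?H)))"
    then have ij: "i < N" "j < N" using H B by auto
    have "(mat_adjoint ?H * (Q * ?H)) $$ (i, j) =
        (\<Sum>m<M. wave k (y m) (\<theta> i) * (\<Sum>l<M. Q $$ (m, l) * exp (\<i> * complex_of_real (k * inner (y l) (\<theta> j)))))"
      using ij H B Q(2)
      by (simp add: scalar_prod_def lessThan_atLeast0 mat_adjoint_H_mat_index) (simp add: H_mat_def)
    also have "\<dots> = (\<Sum>m<M. \<Sum>l<M. Q $$ (m, l) *
        exp (\<i> * complex_of_real (k * (inner (y l) (\<theta> j) - inner (\<theta> i) (y m)))))"
      by (simp add: sum_distrib_left wave_def exp_add[symmetric] mult.left_commute[of "exp _"] algebra_simps)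
    finally show "F_mat M y k \<alpha> \<theta> N $$ (i, j) = (- (mat_adjoint ?H * (Q * ?H))) $$ (i, j)"
      using ij H B Q by (simp add: F_mat_def far_field_def)
  qed (use H B in \<open>auto simp: F_mat_def\<close>)
qed

theorem theorem3p2:
  fixes M :: nat
    and y :: "nat \<Rightarrow> real^3"
    and \<alpha> :: "nat \<Rightarrow> complex"
    and k :: real
    and \<theta> :: "nat \<Rightarrow> real^3"
    and K :: "(real^3) set"
  assumes "inj_on y {..<M}"
    and "\<forall>j<M. Im (\<alpha> j) \<ge> 0"
    and "k > 0"
    and "invertible_mat (P_mat M y k \<alpha>)"
    and "\<forall>n. \<theta> n \<in> sphere 0 1"
    and "\<forall>f. analytic_on_sphere f \<longrightarrow> (\<forall>n. f (\<theta> n) = 0) \<longrightarrow> (\<forall>x\<in>sphere 0 1. f x = 0)"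
    and "compact K"
    and "y ` {..<M} \<subseteq> K"
  shows "\<exists>N0. \<forall>N\<ge>N0. N \<ge> M \<longrightarrow>
    (\<forall>z\<in>K.
       (z \<in> y ` {..<M} \<longleftrightarrow>
          phi_vec k \<theta> N z \<in> mat_range (mat_adjoint (H_mat M y k \<theta> N))) \<and>
       (phi_vec k \<theta> N z \<in> mat_range (mat_adjoint (H_mat M y k \<theta> N)) \<longleftrightarrow>
          phi_vec k \<theta> N z \<in> mat_range (F_mat M y k \<alpha> \<theta> N)) \<and>
       (phi_vec k \<theta> N z \<in> mat_range (F_mat M y k \<alpha> \<theta> N) \<longleftrightarrow>
          orth_proj N (orth_compl N (mat_range (F_mat M y k \<alpha> \<theta> N))) (phi_vec k \<theta> N z) = 0\<^sub>v N)) \<and>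
    vec_space.rank M (H_mat M y k \<theta> N) = M"
proof -
  interpret unisolvent_directions k \<theta>
    using assms(3,6) by unfold_locales blast+
  let ?Y = "y ` {..<M}"
  have Y: "finite ?Y" by simp
  obtain N1 where N1: "\<forall>N\<ge>N1. \<forall>z\<in>K.
      (\<exists>l. \<forall>n<N. wave k z (\<theta> n) = (\<Sum>x\<in>?Y. l x * wave k x (\<theta> n))) \<longrightarrow> z \<in> ?Y"
    using eventually_only_sources_in_span[OF Y assms(7)] ..
  obtain N2 D where N2: "\<forall>N\<ge>N2. \<forall>x\<in>?Y. \<forall>z\<in>?Y.
      (\<Sum>n<N. D x n * wave k z (\<theta> n)) = (if x = z then 1 else 0)"
    using eventually_dual_basis[OF Y] by (elim exE)
  have P: "P_mat M y k \<alpha> \<in> carrier_mat M M" by (simp add: P_mat_def)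
  obtain Q where Q: "mat_inverse (P_mat M y k \<alpha>) = Some Q" "Q \<in> carrier_mat M M" "Q * P_mat M y k \<alpha> = 1\<^sub>m M"
    by (rule invertible_mat_imp_mat_inverse[OF assms(4) P])
  have main: "(\<forall>z\<in>K.
       (z \<in> ?Y \<longleftrightarrow> phi_vec k \<theta> N z \<in> mat_range (mat_adjoint (H_mat M y k \<theta> N))) \<and>
       (phi_vec k \<theta> N z \<in> mat_range (mat_adjoint (H_mat M y k \<theta> N)) \<longleftrightarrow>
          phi_vec k \<theta> N z \<in> mat_range (F_mat M y k \<alpha> \<theta> N)) \<and>
       (phi_vec k \<theta> N z \<in> mat_range (F_mat M y k \<alpha> \<theta> N) \<longleftrightarrow>
          orth_proj N (orth_compl N (mat_range (F_mat M y k \<alpha> \<theta> N))) (phi_vec k \<theta> N z) = 0\<^sub>v N)) \<and>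
    vec_space.rank M (H_mat M y k \<theta> N) = M" if N: "N \<ge> max N1 N2" for N
  proof -
    let ?H = "H_mat M y k \<theta> N"
    have H: "?H \<in> carrier_mat M N" by (rule H_mat_carrier)
    have B: "mat_adjoint ?H \<in> carrier_mat N M" by (rule mat_adjoint_carrier[OF H])
    define C where "C = mat N M (\<lambda>(n, m). cnj (D (y m) n))"
    have C: "C \<in> carrier_mat N M" by (simp add: C_def)
    have HC: "?H * C = 1\<^sub>m M"
    proof (rule eq_matI)
      fix i j assume "i < dim_row (1\<^sub>m M)" "j < dim_col (1\<^sub>m M)"
      then have ij: "i < M" "j < M" by auto
      have "(?H * C) $$ (i, j) = (\<Sum>n<N. cnj (D (y j) n * wave k (y i) (\<theta> n)))"
        using ij by (simp add: H_mat_def C_def scalar_prod_def lessThan_atLeast0 wave_def exp_cnj inner_commute mult.commute)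
      also have "\<dots> = cnj (if y j = y i then 1 else 0)"
        unfolding cnj_sum[symmetric] using N2[rule_format, of N "y j" "y i"] N ij by simp
      also have "\<dots> = 1\<^sub>m M $$ (i, j)" using ij assms(1) by (auto dest: inj_onD)
      finally show "(?H * C) $$ (i, j) = 1\<^sub>m M $$ (i, j)" .
    qed (use H C in auto)
    have RF: "mat_range (F_mat M y k \<alpha> \<theta> N) = mat_range (mat_adjoint ?H)"
      unfolding F_mat_factorization[OF Q(1,2)] by (rule mat_range_eq_left_factor[OF B H C Q(2) P HC Q(3)])
    have first: "z \<in> ?Y \<longleftrightarrow> phi_vec k \<theta> N z \<in> mat_range (mat_adjoint ?H)" if "z \<in> K" for z
    proof
      assume z: "z \<in> ?Y"
      have "wave k z (\<theta> n) = (\<Sum>x\<in>?Y. (if x = z then 1 else 0) * wave k x (\<theta> n))" for n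
        using z by (simp add: if_distrib[of "\<lambda>x. x * _"] cong: if_cong)
      then show "phi_vec k \<theta> N z \<in> mat_range (mat_adjoint ?H)"
        unfolding phi_vec_in_range_H_iff[OF assms(1)]
        by (intro exI[of _ "\<lambda>x. if x = z then 1 else 0"] allI impI)
    next
      assume "phi_vec k \<theta> N z \<in> mat_range (mat_adjoint ?H)"
      then show "z \<in> ?Y"
        unfolding phi_vec_in_range_H_iff[OF assms(1)] using N1 N that by (meson max.boundedE)
    qed
    have last: "phi_vec k \<theta> N z \<in> mat_range (mat_adjoint ?H) \<longleftrightarrow>
        orth_proj N (orth_compl N (mat_range (mat_adjoint ?H))) (phi_vec k \<theta> N z) = 0\<^sub>v N" for z
    proof -
      have phi: "phi_vec k \<theta> N z \<in> carrier_vec N" by (simp add: phi_vec_def)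
      obtain r where r: "r \<in> mat_range (mat_adjoint ?H)"
          "phi_vec k \<theta> N z - r \<in> orth_compl N (mat_range (mat_adjoint ?H))"
        using orthogonal_decomposition_range_adjoint[OF H C HC phi] by blast
      have "mat_range (mat_adjoint ?H) \<subseteq> carrier_vec N" using B by (auto simp: mat_range_def)
      from orth_proj_orth_compl_eq_0_iff[OF this phi r] show ?thesis by simp
    qed
    show ?thesis
      unfolding RF using first last rank_eq_if_right_inverse[OF H C HC] by simp
  qed
  show ?thesis
    by (rule exI[of _ "max N1 N2"], intro allI impI, rule main)
qed

end
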